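(* Let $n$ and $p\ge 3$ be two prime numbers, and for each positive integer $\alpha$ let $r=r_\alpha$ be a natural number such that $\gcd(p^\alpha,n)=\gcd(p^\alpha,r-1)=1$ and $r^n\equiv 1\pmod{p^\alpha}$, so that $ZM(p^\alpha,n,r)=\langle a,b\mid a^{p^\alpha}=b^n=1,\ b^{-1}ab=a^r\rangle$ is a ZM-group. Then (i) $$\lim_{\alpha\to\infty}sd(ZM(p^\alpha,n,r))=0;$$ (ii) $$\lim_{\alpha\to\infty}csd(ZM(p^\alpha,n,r))=0.$$
   Context: For a finite group $G$, $L(G)$ denotes the set of all subgroups of $G$ and $L_1(G)$ the set of all cyclic subgroups of $G$. The subgroup commutativity degree and the cyclic subgroup commutativity degree of $G$ are $sd(G)=\frac{1}{|L(G)|^2}|\{(H,K)\in L(G)^2\mid HK=KH\}|$ and $csd(G)=\frac{1}{|L_1(G)|^2}|\{(H,K)\in L_1(G)^2\mid HK=KH\}|$, where $HK=\{hk\mid h\in H,k\in K\}$. In general, for natural numbers $m,n\ge1$ and $r$ with $\gcd(m,n)=\gcd(m,r-1)=1$ and $r^n\equiv 1\pmod m$, the ZM-group $ZM(m,n,r)$ is the finite group of order $mn$ with presentation $\langle a,b\mid a^m=b^n=1,\ b^{-1}ab=a^r\rangle$. *)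

theory Defs
  imports "HOL-Analysis.Analysis" "HOL-Number_Theory.Cong" "HOL-Algebra.Elementary_Groups"
begin

section \<open>Subgroup commutativity degrees\<close>

definition subgroups_of :: "('a, 'b) monoid_scheme \<Rightarrow> 'a set set" where
  "subgroups_of G = {H. subgroup H G}"

definition cyclic_subgroups_of :: "('a, 'b) monoid_scheme \<Rightarrow> 'a set set" where
  "cyclic_subgroups_of G = {H. subgroup H G \<and> cyclic_group (G\<lparr>carrier := H\<rparr>)}"

text \<open>Both degrees are meant for finite groups only; on a group with infinitely many
  (cyclic) subgroups they take the junk value 0.\<close>

definition sd :: "('a, 'b) monoid_scheme \<Rightarrow> real" where
  "sd G = real (card {(H, K). H \<in> subgroups_of G \<and> K \<in> subgroups_of G \<and>
                        H <#>\<^bsub>G\<^esub> K = K <#>\<^bsub>G\<^esub> H})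
            / (real (card (subgroups_of G)))\<^sup>2"

definition csd :: "('a, 'b) monoid_scheme \<Rightarrow> real" where
  "csd G = real (card {(H, K). H \<in> cyclic_subgroups_of G \<and> K \<in> cyclic_subgroups_of G \<and>
                        H <#>\<^bsub>G\<^esub> K = K <#>\<^bsub>G\<^esub> H})
            / (real (card (cyclic_subgroups_of G)))\<^sup>2"


section \<open>Groups given by generators and relations\<close>

text \<open>The group presented by generators \<open>'g\<close> (all elements of the type) and a set \<open>R\<close> of
  relations \<open>u = v\<close> consists of the words in the generators and their formal inverses modulo
  the least congruence for concatenation which contains \<open>R\<close> and makes every letter cancel
  against its formal inverse.\<close>

datatype 'g letter = Gen 'g | InvGen 'g

fun inv_letter :: "'g letter \<Rightarrow> 'g letter" where
  "inv_letter (Gen x) = InvGen x"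
| "inv_letter (InvGen x) = Gen x"

inductive_set word_congruence ::
    "('g letter list \<times> 'g letter list) set \<Rightarrow> ('g letter list \<times> 'g letter list) set"
  for R where
  refl: "(u, u) \<in> word_congruence R"
| sym: "(u, v) \<in> word_congruence R \<Longrightarrow> (v, u) \<in> word_congruence R"
| trans: "(u, v) \<in> word_congruence R \<Longrightarrow> (v, w) \<in> word_congruence R \<Longrightarrow> (u, w) \<in> word_congruence R"
| append: "(u, v) \<in> word_congruence R \<Longrightarrow> (u', v') \<in> word_congruence R
             \<Longrightarrow> (u @ u', v @ v') \<in> word_congruence R"
| cancel: "([l, inv_letter l], []) \<in> word_congruence R"
| rel: "(u, v) \<in> R \<Longrightarrow> (u, v) \<in> word_congruence R"

definition presented_group ::
    "('g letter list \<times> 'g letter list) set \<Rightarrow> 'g letter list set monoid" where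
  "presented_group R =
     \<lparr>carrier = UNIV // word_congruence R,
      mult = (\<lambda>A B. \<Union>u\<in>A. \<Union>v\<in>B. word_congruence R `` {u @ v}),
      one = word_congruence R `` {[]}\<rparr>"

lemma equiv_word_congruence: "equiv UNIV (word_congruence R)"
proof (rule equivI)
  show "refl (word_congruence R)"
    by (rule refl_onI) (rule word_congruence.refl)
  show "Relation.sym (word_congruence R)"
    by (rule symI) (rule word_congruence.sym)
  show "Relation.trans (word_congruence R)"
    by (rule transI) (rule word_congruence.trans)
qed simp

lemma presented_group_mult:
  "(word_congruence R `` {u}) \<otimes>\<^bsub>presented_group R\<^esub> (word_congruence R `` {v}) =
     word_congruence R `` {u @ v}"
proof -
  have *: "word_congruence R `` {u' @ v'} = word_congruence R `` {u @ v}"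
    if "u' \<in> word_congruence R `` {u}" "v' \<in> word_congruence R `` {v}" for u' v'
  proof (rule equiv_class_eq[OF equiv_word_congruence])
    show "(u' @ v', u @ v) \<in> word_congruence R"
      using that by (auto intro: word_congruence.append word_congruence.sym)
  qed
  have ne: "u \<in> word_congruence R `` {u}" "v \<in> word_congruence R `` {v}"
    by (simp_all add: word_congruence.refl)
  have "(\<Union>u'\<in>word_congruence R `` {u}. \<Union>v'\<in>word_congruence R `` {v}.
           word_congruence R `` {u' @ v'}) = word_congruence R `` {u @ v}"
  proof (rule Set.set_eqI, rule iffI)
    fix w
    assume "w \<in> (\<Union>u'\<in>word_congruence R `` {u}. \<Union>v'\<in>word_congruence R `` {v}.
                   word_congruence R `` {u' @ v'})"
    then obtain u' v' where "u' \<in> word_congruence R `` {u}" "v' \<in> word_congruence R `` {v}"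
      "w \<in> word_congruence R `` {u' @ v'}"
      by (elim UN_E)
    then show "w \<in> word_congruence R `` {u @ v}"
      by (simp only: *)
  next
    fix w
    assume "w \<in> word_congruence R `` {u @ v}"
    then show "w \<in> (\<Union>u'\<in>word_congruence R `` {u}. \<Union>v'\<in>word_congruence R `` {v}.
                   word_congruence R `` {u' @ v'})"
      by (intro UN_I[OF ne(1)] UN_I[OF ne(2)])
  qed
  then show ?thesis
    by (simp only: presented_group_def monoid.simps partial_object.simps)
qed

lemma inv_letter_word:
  "(rev (map inv_letter w) @ w, []) \<in> word_congruence R"
proof (induction w)
  case Nil
  show ?case by (simp add: word_congruence.refl)
next
  case (Cons l w)
  have "([inv_letter l, l], []) \<in> word_congruence R"
    using word_congruence.cancel[of "inv_letter l" R] by (cases l) auto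
  then have "(rev (map inv_letter w) @ [inv_letter l, l] @ w, rev (map inv_letter w) @ [] @ w)
               \<in> word_congruence R"
    by (intro word_congruence.append word_congruence.refl)
  then have "(rev (map inv_letter (l # w)) @ l # w, rev (map inv_letter w) @ w) \<in> word_congruence R"
    by simp
  from word_congruence.trans[OF this Cons.IH] show ?case .
qed

lemma group_presented_group: "group (presented_group R)"
proof (rule groupI)
  let ?G = "presented_group R"
  have carr: "\<And>x. x \<in> carrier ?G \<longleftrightarrow> (\<exists>u. x = word_congruence R `` {u})"
    by (auto simp: presented_group_def quotient_def)
  have one: "\<one>\<^bsub>?G\<^esub> = word_congruence R `` {[]}"
    by (simp add: presented_group_def)
  show "x \<otimes>\<^bsub>?G\<^esub> y \<in> carrier ?G" if "x \<in> carrier ?G" "y \<in> carrier ?G" for x y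
  proof -
    from that obtain u v where "x = word_congruence R `` {u}" "y = word_congruence R `` {v}"
      unfolding carr by blast
    then show ?thesis
      unfolding carr by (auto simp: presented_group_mult)
  qed
  show "\<one>\<^bsub>?G\<^esub> \<in> carrier ?G"
    unfolding carr one by blast
  show "x \<otimes>\<^bsub>?G\<^esub> y \<otimes>\<^bsub>?G\<^esub> z = x \<otimes>\<^bsub>?G\<^esub> (y \<otimes>\<^bsub>?G\<^esub> z)"
    if "x \<in> carrier ?G" "y \<in> carrier ?G" "z \<in> carrier ?G" for x y z
  proof -
    from that obtain u v w where "x = word_congruence R `` {u}" "y = word_congruence R `` {v}"
      "z = word_congruence R `` {w}"
      unfolding carr by blast
    then show ?thesis
      by (simp only: presented_group_mult append_assoc)
  qed
  show "\<one>\<^bsub>?G\<^esub> \<otimes>\<^bsub>?G\<^esub> x = x" if "x \<in> carrier ?G" for x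
  proof -
    from that obtain u where "x = word_congruence R `` {u}"
      unfolding carr by blast
    then show ?thesis
      by (simp only: one presented_group_mult append_Nil)
  qed
  show "\<exists>y\<in>carrier ?G. y \<otimes>\<^bsub>?G\<^esub> x = \<one>\<^bsub>?G\<^esub>" if "x \<in> carrier ?G" for x
  proof -
    from that obtain u where x: "x = word_congruence R `` {u}"
      unfolding carr by blast
    have "word_congruence R `` {rev (map inv_letter u)} \<otimes>\<^bsub>?G\<^esub> x = \<one>\<^bsub>?G\<^esub>"
      unfolding x one presented_group_mult
      by (rule equiv_class_eq[OF equiv_word_congruence inv_letter_word])
    then show ?thesis
      using carr by blast
  qed
qed


section \<open>ZM-groups\<close>

datatype zm_gen = a | b

text \<open>The relations are \<open>a\<^sup>m = 1\<close>, \<open>b\<^sup>n = 1\<close> and \<open>b\<^sup>-\<^sup>1 a b = a\<^sup>r\<close>.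
  The conditions under which the presentation defines a ZM-group of order \<open>m n\<close>
  (\<open>gcd m n = gcd m (r - 1) = 1\<close> and \<open>r\<^sup>n \<equiv> 1 (mod m)\<close>) have to be assumed separately.\<close>

definition ZM :: "nat \<Rightarrow> nat \<Rightarrow> nat \<Rightarrow> zm_gen letter list set monoid" where
  "ZM m n r = presented_group
     {(replicate m (Gen a), []),
      (replicate n (Gen b), []),
      ([InvGen b, Gen a, Gen b], replicate r (Gen a))}"

hide_const (open) a b

end

theory Submission
  imports Defs "HOL-Algebra.Multiplicative_Group"
begin

text \<open>Let \<open>A\<close> be the normal subgroup generated by \<open>a\<close>; it is a cyclic \<open>p\<close>-group, so its subgroups form
  a chain of at most \<open>\<alpha> + 1\<close> members. If \<open>H\<close> and \<open>K\<close> are permutable and neither lies in \<open>A\<close>, then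
  \<open>|HK| |H \<inter> K| = |H| |K|\<close> shows that \<open>n\<close> divides \<open>|H \<inter> K|\<close>, so that \<open>H \<inter> K\<close> is not contained in \<open>A\<close>. Since
  the index of \<open>A\<close> divides the prime \<open>n\<close>, it follows that \<open>H = (H \<inter> K)(H \<inter> A)\<close> and \<open>K = (H \<inter> K)(K \<inter> A)\<close>, and
  one of \<open>H\<close>, \<open>K\<close> contains the other; moreover the larger one is determined by the smaller one and its
  intersection with \<open>A\<close>. Hence a family of \<open>N\<close> subgroups has at most \<open>4 (\<alpha> + 1) N\<close> permutable pairs.

  On the other hand, the group acts on the integers modulo \<open>p\<^sup>\<alpha>\<close> by affine maps, and comparing fixed
  points shows that the \<open>p\<^sup>\<alpha>\<close> conjugates of \<open>b\<close> by powers of \<open>a\<close> generate distinct cyclic subgroups.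
  Both degrees are therefore at most \<open>4 (\<alpha> + 1) / p\<^sup>\<alpha>\<close>.\<close>

section \<open>Products of subgroups and subgroups of cyclic groups\<close>

text \<open>Count \<open>H \<times> K\<close> by the fibres of multiplication: the fibre over
  \<open>h \<otimes> k\<close> consists of the pairs
  \<open>(h \<otimes> d, inv d \<otimes> k)\<close> with \<open>d\<close> in
  \<open>H \<inter> K\<close>, so all fibres have the size of the intersection.\<close>

lemma (in group) card_set_mult_inter:
  assumes "finite (carrier G)" and H: "subgroup H G" and K: "subgroup K G"
  shows "card (H <#> K) * card (H \<inter> K) = card H * card K"
proof -
  have sub: "H \<subseteq> carrier G" "K \<subseteq> carrier G"
    using H K by (auto dest: subgroup.subset)
  then have fin: "finite H" "finite K"
    using assms(1) by (auto intro: finite_subset)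
  define F where "F g = {(h, k) \<in> H \<times> K. h \<otimes> k = g}" for g
  have "finite (F g)" for g
    by (rule finite_subset[of _ "H \<times> K"]) (auto simp: F_def fin)
  have card_F: "card (F g) = card (H \<inter> K)" if g: "g \<in> H <#> K" for g
  proof -
    obtain h k where hk: "h \<in> H" "k \<in> K" "g = h \<otimes> k"
      using g unfolding set_mult_def by blast
    have hkc: "h \<in> carrier G" "k \<in> carrier G"
      using hk sub by auto
    have "bij_betw (\<lambda>d. (h \<otimes> d, inv d \<otimes> k)) (H \<inter> K) (F g)"
    proof (rule bij_betwI[where g = "\<lambda>(x, y). inv h \<otimes> x"])
      show "(\<lambda>d. (h \<otimes> d, inv d \<otimes> k)) \<in> H \<inter> K \<rightarrow> F g"
      proof
        fix d assume d: "d \<in> H \<inter> K"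
        then have "d \<in> carrier G" using sub by auto
        moreover have "h \<otimes> d \<in> H" "inv d \<otimes> k \<in> K"
          using d hk H K by (auto intro: subgroup.m_closed subgroup.m_inv_closed)
        ultimately show "(h \<otimes> d, inv d \<otimes> k) \<in> F g"
          using hkc hk(3) by (simp add: F_def m_assoc[symmetric]) (simp add: m_assoc)
      qed
      show "(\<lambda>(x, y). inv h \<otimes> x) \<in> F g \<rightarrow> H \<inter> K"
      proof
        fix q assume "q \<in> F g"
        then obtain x y where q: "q = (x, y)" "x \<in> H" "y \<in> K" "x \<otimes> y = h \<otimes> k"
          using hk(3) unfolding F_def by auto
        then have c: "x \<in> carrier G" "y \<in> carrier G" using sub by auto
        have "inv h \<otimes> x = k \<otimes> inv y"
          using q(4) c hkc by (metis inv_solve_left inv_solve_right m_assoc inv_closed m_closed)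
        moreover have "inv h \<otimes> x \<in> H" "k \<otimes> inv y \<in> K"
          using q hk H K by (auto intro: subgroup.m_closed subgroup.m_inv_closed)
        ultimately show "(case q of (x, y) \<Rightarrow> inv h \<otimes> x) \<in> H \<inter> K"
          using q(1) by simp
      qed
      show "(case (h \<otimes> d, inv d \<otimes> k) of (x, y) \<Rightarrow> inv h \<otimes> x) = d" if "d \<in> H \<inter> K" for d
        using that sub hkc by (auto simp: subset_iff simp flip: m_assoc)
      show "(h \<otimes> (case q of (x, y) \<Rightarrow> inv h \<otimes> x), inv (case q of (x, y) \<Rightarrow> inv h \<otimes> x) \<otimes> k) = q"
        if q: "q \<in> F g" for q
      proof -
        obtain x y where q: "q = (x, y)" "x \<in> H" "y \<in> K" "x \<otimes> y = h \<otimes> k"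
          using q hk(3) unfolding F_def by auto
        then have c: "x \<in> carrier G" "y \<in> carrier G" using sub by auto
        have "h \<otimes> (inv h \<otimes> x) = x"
          using c hkc by (simp flip: m_assoc)
        moreover have "inv x \<otimes> (h \<otimes> k) = y"
          using c unfolding q(4)[symmetric] by (simp flip: m_assoc)
        ultimately show ?thesis
          using q(1) c hkc by (simp add: inv_mult_group m_assoc)
      qed
    qed
    then show ?thesis by (simp add: bij_betw_same_card)
  qed
  have "H \<times> K = (\<Union>g\<in>H <#> K. F g)"
    by (auto simp: F_def set_mult_def)
  also have "card \<dots> = (\<Sum>g\<in>H <#> K. card (F g))"
  proof (rule card_UN_disjoint)
    show "finite (H <#> K)"
      using fin by (simp add: set_mult_def)
    show "\<forall>g\<in>H <#> K. \<forall>g'\<in>H <#> K. g \<noteq> g' \<longrightarrow> F g \<inter> F g' = {}"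
      by (auto simp: F_def)
  qed (use \<open>\<And>g. finite (F g)\<close> in blast)
  finally show ?thesis
    by (simp add: card_F card_cartesian_product)
qed

lemma (in group) subgroup_set_mult_permutable:
  assumes H: "subgroup H G" and K: "subgroup K G" and comm: "H <#> K = K <#> H"
  shows "subgroup (H <#> K) G"
proof (rule subgroupI)
  have sub: "H \<subseteq> carrier G" "K \<subseteq> carrier G"
    using H K by (auto dest: subgroup.subset)
  then show "H <#> K \<subseteq> carrier G" by (rule set_mult_closed)
  show "H <#> K \<noteq> {}"
    using subgroup.one_closed[OF H] subgroup.one_closed[OF K] by (auto simp: set_mult_def)
  show "inv x \<in> H <#> K" if x: "x \<in> H <#> K" for x
  proof -
    obtain h k where hk: "h \<in> H" "k \<in> K" "x = h \<otimes> k"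
      using x unfolding set_mult_def by blast
    then have "inv x = inv k \<otimes> inv h"
      using sub by (auto intro!: inv_mult_group)
    moreover have "inv k \<in> K" "inv h \<in> H"
      using hk H K by (auto intro: subgroup.m_inv_closed)
    ultimately show ?thesis
      unfolding comm by (auto simp: set_mult_def)
  qed
  show "x \<otimes> y \<in> H <#> K" if x: "x \<in> H <#> K" and y: "y \<in> H <#> K" for x y
  proof -
    have "x \<otimes> y \<in> (H <#> K) <#> (H <#> K)"
      using x y by (auto simp: set_mult_def)
    also have "(H <#> K) <#> (H <#> K) = H <#> (K <#> H) <#> K"
      using sub by (simp add: set_mult_assoc set_mult_closed)
    also have "\<dots> = (H <#> H) <#> (K <#> K)"
      using sub by (simp add: set_mult_assoc set_mult_closed flip: comm)
    also have "\<dots> = H <#> K"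
      using H K by (simp add: subgroup_mult_id)
    finally show ?thesis .
  qed
qed

lemma (in group) card_subgroup_dvd:
  assumes "subgroup H G" "subgroup K G" "H \<subseteq> K"
  shows "card H dvd card K"
proof -
  interpret K: group "G\<lparr>carrier := K\<rparr>"
    by (rule subgroup_imp_group) fact
  have "subgroup H (G\<lparr>carrier := K\<rparr>)"
    by (rule subgroup_incl) fact+
  from K.lagrange[OF this, symmetric] show ?thesis
    by (simp add: order_def)
qed

lemma (in group) pow_card_subgroup:
  assumes "finite (carrier G)" "subgroup H G" "x \<in> H"
  shows "x [^] card H = \<one>"
proof -
  interpret H: group "G\<lparr>carrier := H\<rparr>"
    by (rule subgroup_imp_group) fact
  have "x [^]\<^bsub>G\<lparr>carrier := H\<rparr>\<^esub> card H = \<one>"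
    using H.pow_order_eq_1[of x] assms(3) by (simp add: order_def)
  then show ?thesis
    by (simp flip: nat_pow_consistent)
qed

text \<open>In a cyclic group the equation \<open>x [^] card K = \<one>\<close> has at most
  \<open>card K\<close> solutions, because \<open>card K\<close> divides the order. So
  \<open>K\<close> is the full solution set \<open>S\<close>, and the elements of \<open>H\<close>
  are solutions since \<open>card H\<close> divides \<open>card K\<close>.\<close>

lemma (in group) cyclic_subgroup_subset:
  assumes fin: "finite (carrier G)" and a: "a \<in> carrier G"
    and H: "subgroup H G" "H \<subseteq> generate G {a}"
    and K: "subgroup K G" "K \<subseteq> generate G {a}"
    and dvd: "card H dvd card K"
  shows "H \<subseteq> K"
proof -
  define S where "S = {x \<in> generate G {a}. x [^] card K = \<one>}"
  have "card K dvd ord a"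
    using card_subgroup_dvd[OF K(1) _ K(2)] a
    by (simp add: generate_is_subgroup generate_pow_card)
  then obtain e where e: "ord a = card K * e" by blast
  have "ord a > 0" using ord_ge_1[OF fin a] by simp
  have "S \<subseteq> (\<lambda>j. a [^] (j * e)) ` {..<card K}"
  proof
    fix x assume x: "x \<in> S"
    then obtain i where "i \<le> ord a - 1" and i: "x = a [^] i"
      using a ord_elems[OF fin a] by (auto simp: S_def generate_pow_on_finite_carrier[OF fin])
    then have "i < ord a" using \<open>ord a > 0\<close> by linarith
    have "a [^] (i * card K) = \<one>"
      using x a by (simp add: S_def i nat_pow_pow)
    then have "card K * e dvd i * card K"
      by (simp add: pow_eq_id a flip: e)
    then obtain j where "i = j * e"
      using e \<open>ord a > 0\<close> by (auto simp: mult.commute)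
    then show "x \<in> (\<lambda>j. a [^] (j * e)) ` {..<card K}"
      using \<open>i < ord a\<close> e i by auto
  qed
  then have "finite S" "card S \<le> card K"
    using surj_card_le[of "{..<card K}" S] by (auto intro: finite_surj)
  moreover have "K \<subseteq> S"
    using K by (auto simp: S_def pow_card_subgroup[OF fin])
  ultimately have "K = S"
    by (simp add: card_seteq)
  have "x \<in> S" if "x \<in> H" for x
  proof -
    obtain c where "card K = card H * c" using dvd by blast
    moreover have "x [^] card H = \<one>" "x \<in> carrier G"
      using that H pow_card_subgroup[OF fin H(1)] by (auto dest: subgroup.mem_carrier)
    ultimately have "x [^] card K = \<one>"
      by (simp flip: nat_pow_pow)
    then show ?thesis using that H by (auto simp: S_def)
  qed
  then show ?thesis unfolding \<open>K = S\<close> by blast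
qed

section \<open>Permutable subgroups when a cyclic normal p-subgroup has index dividing a
  prime\<close>

text \<open>The orders enter through divisibilities because the relations of a presentation bound
  orders from above only.\<close>

locale prime_index_cyclic_normal = group +
  fixes a p n k
  assumes fin: "finite (carrier G)"
    and a: "a \<in> carrier G"
    and normal: "generate G {a} \<lhd> G"
    and p: "prime (p :: nat)" and n: "prime (n :: nat)" and n_neq_p: "n \<noteq> p"
    and ord_a: "ord a dvd p ^ k"
    and order_G: "order G dvd n * ord a"
begin

definition A where "A = generate G {a}"

lemma A_subgroup: "subgroup A G"
  using a by (simp add: A_def generate_is_subgroup)

lemma card_A: "card A = ord a"
  using a by (simp add: A_def generate_pow_card)

definition subgroups_of_A where "subgroups_of_A = {H. subgroup H G \<and> H \<subseteq> A}"

lemma card_subgroups_of_A_dvd: "H \<in> subgroups_of_A \<Longrightarrow> card H dvd p ^ k"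
  using card_subgroup_dvd[OF _ A_subgroup] ord_a card_A dvd_trans unfolding subgroups_of_A_def by fastforce

lemma finite_subgroup: "subgroup H G \<Longrightarrow> finite H"
  using fin by (meson finite_subset subgroup.subset)

lemma card_subgroup_pos: "subgroup H G \<Longrightarrow> card H > 0"
  using fin by (simp add: subgroup.finite_imp_card_positive)

lemma subgroups_of_A_subset:
  "H \<in> subgroups_of_A \<Longrightarrow> K \<in> subgroups_of_A \<Longrightarrow> card H dvd card K \<Longrightarrow> H \<subseteq> K"
  using cyclic_subgroup_subset[OF fin a] unfolding subgroups_of_A_def A_def by blast

lemma subgroups_of_A_total:
  assumes "H \<in> subgroups_of_A" "K \<in> subgroups_of_A" shows "H \<subseteq> K \<or> K \<subseteq> H"
proof -
  obtain i j where "card H = p ^ i" "card K = p ^ j"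
    using card_subgroups_of_A_dvd assms p by (metis divides_primepow_nat)
  then show ?thesis
    using subgroups_of_A_subset assms le_imp_power_dvd nat_le_linear by metis
qed

lemma inj_on_card_subgroups_of_A: "inj_on card subgroups_of_A"
  by (intro inj_onI subset_antisym subgroups_of_A_subset) auto

lemma card_image_subgroups_of_A: "card ` subgroups_of_A \<subseteq> (\<lambda>i. p ^ i) ` {..k}"
  using card_subgroups_of_A_dvd p by (auto simp: divides_primepow_nat)

lemma finite_subgroups_of_A: "finite subgroups_of_A"
  using inj_on_card_subgroups_of_A card_image_subgroups_of_A
  by (meson finite_imageD finite_atMost finite_imageI finite_subset)

text \<open>A subgroup of the cyclic group \<open>A\<close> is determined by its order, which is one
  of \<open>p ^ 0\<close>, ..., \<open>p ^ k\<close>.\<close>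

lemma card_subgroups_of_A_le: "card subgroups_of_A \<le> k + 1"
  using card_image[OF inj_on_card_subgroups_of_A] surj_card_le[OF _ card_image_subgroups_of_A] by simp

lemma Int_A_subgroups_of_A: "subgroup H G \<Longrightarrow> H \<inter> A \<in> subgroups_of_A"
  using A_subgroup by (simp add: subgroups_of_A_def subgroups_Inter_pair)

text \<open>The index \<open>e\<close> of \<open>A\<close> in \<open>H <#> A\<close> divides the
  prime \<open>n\<close> and is not 1, so it equals \<open>n\<close>; the product formula for
  \<open>H\<close> and \<open>A\<close> turns this into the index of \<open>H \<inter> A\<close> in
  \<open>H\<close>.\<close>

lemma card_not_subset_A:
  assumes H: "subgroup H G" and HA: "\<not> H \<subseteq> A"
  shows "card H = n * card (H \<inter> A)"
proof -
  have L: "subgroup (H <#> A) G"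
    using subgroup_set_mult_permutable[OF H A_subgroup] commut_normal[OF H normal]
    by (simp add: A_def)
  have sub: "A \<subseteq> H <#> A" "H \<subseteq> H <#> A"
    using subgroup.one_closed[OF H] subgroup.one_closed[OF A_subgroup]
      subgroup.subset[OF H] subgroup.subset[OF A_subgroup]
    unfolding set_mult_def by force+
  then obtain e where e: "card (H <#> A) = card A * e"
    using card_subgroup_dvd[OF A_subgroup L] by blast
  have "card (H <#> A) dvd order G"
    using lagrange[OF L] by (metis dvd_triv_right)
  then have "ord a * e dvd ord a * n"
    using order_G e card_A by (simp add: dvd_trans mult.commute)
  then have "e dvd n"
    using card_subgroup_pos[OF A_subgroup] by (simp add: card_A)
  moreover have "e \<noteq> 1"
  proof
    assume "e = 1"
    then have "A = H <#> A"
      using e sub finite_subgroup[OF L] by (simp add: card_subset_eq)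
    then show False using sub HA by blast
  qed
  ultimately have "e = n"
    using n by (auto simp: prime_nat_iff)
  then have "card A * (n * card (H \<inter> A)) = card A * card H"
    using card_set_mult_inter[OF fin H A_subgroup] e by (simp add: ac_simps)
  then show ?thesis
    using card_subgroup_pos[OF A_subgroup] by simp
qed

text \<open>Both \<open>D\<close> and \<open>H\<close> have index factor \<open>n\<close> over their
  intersections with \<open>A\<close>, so the right-hand side, which lies in \<open>H\<close>, has
  the order of \<open>H\<close>. Thus \<open>H\<close> can be recovered from \<open>D\<close> and
  \<open>H \<inter> A\<close>, which serves both comparability and counting.\<close>

lemma eq_set_mult_Int_A:
  assumes D: "subgroup D G" "\<not> D \<subseteq> A" and H: "subgroup H G" and "D \<subseteq> H"
  shows "H = D <#> (H \<inter> A)"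
proof -
  have HA: "subgroup (H \<inter> A) G"
    using H A_subgroup by (rule subgroups_Inter_pair)
  have "D \<inter> (H \<inter> A) = D \<inter> A" using \<open>D \<subseteq> H\<close> by blast
  then have "card (D <#> (H \<inter> A)) * card (D \<inter> A) = n * card (D \<inter> A) * card (H \<inter> A)"
    using card_set_mult_inter[OF fin D(1) HA] card_not_subset_A[OF D] by simp
  moreover have "card (D \<inter> A) > 0"
    using D(1) A_subgroup by (intro card_subgroup_pos subgroups_Inter_pair)
  moreover have "card H = n * card (H \<inter> A)"
    using card_not_subset_A[OF H] assms by blast
  ultimately have "card (D <#> (H \<inter> A)) = card H" by simp
  moreover have "D <#> (H \<inter> A) \<subseteq> H"
    using mono_set_mult[OF \<open>D \<subseteq> H\<close>, of "H \<inter> A" H G] subgroup_mult_id[OF H] by blast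
  ultimately show ?thesis
    using finite_subgroup[OF H] card_subset_eq by metis
qed

text \<open>The intersection \<open>?D\<close> is not inside \<open>A\<close>, so \<open>H\<close>
  and \<open>K\<close> are both products of \<open>?D\<close> with their traces on \<open>A\<close>;
  these traces are comparable because the subgroups of \<open>A\<close> form a chain.\<close>

lemma permutable_imp_comparable:
  assumes H: "subgroup H G" "\<not> H \<subseteq> A" and K: "subgroup K G" "\<not> K \<subseteq> A"
    and comm: "H <#> K = K <#> H"
  shows "H \<subseteq> K \<or> K \<subseteq> H"
proof -
  let ?L = "H <#> K" and ?D = "H \<inter> K"
  have L: "subgroup ?L G"
    using subgroup_set_mult_permutable H K comm by blast
  have D: "subgroup ?D G"
    using H K by (intro subgroups_Inter_pair)
  have "H \<subseteq> ?L"
    using subgroup.one_closed[OF K(1)] subgroup.subset[OF H(1)] unfolding set_mult_def by force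
  then have "\<not> ?L \<subseteq> A" using H by blast
  have "\<not> ?D \<subseteq> A"
  proof
    assume "?D \<subseteq> A"
    then have "?D \<in> subgroups_of_A" using D by (simp add: subgroups_of_A_def)
    have "card ?L * card ?D = card H * card K"
      using card_set_mult_inter[OF fin] H K by blast
    \<comment> \<open>Each of \<open>?L\<close>, \<open>H\<close> and \<open>K\<close> lies outside
      \<open>A\<close> and contributes one factor \<open>n\<close>: one on the left, two on the
      right. The surplus factor would have to divide a power of \<open>p\<close>.\<close>
    then have "n * (card (?L \<inter> A) * card ?D) = n * (n * (card (H \<inter> A) * card (K \<inter> A)))"
      using card_not_subset_A H K L \<open>\<not> ?L \<subseteq> A\<close> by (simp add: ac_simps)
    then have "n dvd card (?L \<inter> A) * card ?D"
      using n by auto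
    then have "n dvd p ^ k"
      using n card_subgroups_of_A_dvd \<open>?D \<in> subgroups_of_A\<close> Int_A_subgroups_of_A[OF L]
      by (meson dvd_trans prime_dvd_mult_iff)
    then show False
      using n p n_neq_p by (metis prime_dvd_power primes_dvd_imp_eq)
  qed
  then have "H = ?D <#> (H \<inter> A)" "K = ?D <#> (K \<inter> A)"
    using eq_set_mult_Int_A[OF D] H K by auto
  moreover have "H \<inter> A \<subseteq> K \<inter> A \<or> K \<inter> A \<subseteq> H \<inter> A"
    using subgroups_of_A_total Int_A_subgroups_of_A H K by blast
  ultimately show ?thesis
    using mono_set_mult[of ?D ?D _ _ G] by (metis order_refl)
qed

lemma finite_subgroups: "finite {H. subgroup H G}"
  by (rule finite_subset[of _ "Pow (carrier G)"]) (use fin in \<open>auto dest: subgroup.subset\<close>)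

text \<open>A permutable pair has a component inside \<open>A\<close>, or it is nested in one of the
  two directions. This gives four sets of at most \<open>(k + 1) * card L\<close> pairs each. The
  family \<open>L\<close> is arbitrary so that the bound applies to all subgroups and to the cyclic
  ones alike.\<close>

lemma card_permutable_pairs_le:
  assumes L: "L \<subseteq> {H. subgroup H G}"
  shows "card {(H, K). H \<in> L \<and> K \<in> L \<and> H <#> K = K <#> H} \<le> 4 * (k + 1) * card L"
proof -
  have "finite L" using L finite_subgroups by (rule finite_subset)
  \<comment> \<open>The nested pairs with the smaller member first, and that member outside
    \<open>A\<close>; the converse relation covers the other direction. A pair is encoded by its
    smaller member and the trace of the larger one on \<open>A\<close>.\<close>
  define M where "M = {(H, K) \<in> L \<times> L. \<not> H \<subseteq> A \<and> H \<subseteq> K}"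
  have "finite M"
    using \<open>finite L\<close> by (auto simp: M_def intro: finite_subset[of _ "L \<times> L"])
  have "K = H <#> (K \<inter> A)" if "(H, K) \<in> M" for H K
    using eq_set_mult_Int_A[of H K] that L by (auto simp only: M_def)
  then have "inj_on (\<lambda>(H, K). (H, K \<inter> A)) M"
    unfolding inj_on_def by (metis (no_types, lifting) case_prod_conv prod.inject surj_pair)
  moreover have "(\<lambda>(H, K). (H, K \<inter> A)) ` M \<subseteq> L \<times> subgroups_of_A"
    using Int_A_subgroups_of_A L by (auto simp: M_def)
  ultimately have "card M \<le> card (L \<times> subgroups_of_A)"
    using \<open>finite L\<close> finite_subgroups_of_A by (intro card_inj_on_le) auto
  also have "\<dots> \<le> (k + 1) * card L"
    using mult_le_mono2[OF card_subgroups_of_A_le, of "card L"]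
    by (simp add: card_cartesian_product mult.commute)
  finally have M: "card M \<le> (k + 1) * card L" .
  have LB: "card (L \<times> subgroups_of_A) \<le> (k + 1) * card L" "card (subgroups_of_A \<times> L) \<le> (k + 1) * card L"
    using mult_le_mono2[OF card_subgroups_of_A_le, of "card L"]
    by (simp_all add: card_cartesian_product mult.commute)
  have "{(H, K). H \<in> L \<and> K \<in> L \<and> H <#> K = K <#> H}
      \<subseteq> L \<times> subgroups_of_A \<union> subgroups_of_A \<times> L \<union> (M \<union> M\<inverse>)"
  proof (rule subrelI)
    fix H K
    assume "(H, K) \<in> {(H, K). H \<in> L \<and> K \<in> L \<and> H <#> K = K <#> H}"
    then have HK: "H \<in> L" "K \<in> L" "H <#> K = K <#> H" by auto
    moreover have sg: "subgroup H G" "subgroup K G"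
      using HK L by auto
    ultimately show "(H, K) \<in> L \<times> subgroups_of_A \<union> subgroups_of_A \<times> L \<union> (M \<union> M\<inverse>)"
      using permutable_imp_comparable[of H K] by (simp add: M_def subgroups_of_A_def) blast
  qed
  then have "card {(H, K). H \<in> L \<and> K \<in> L \<and> H <#> K = K <#> H}
      \<le> card (L \<times> subgroups_of_A \<union> subgroups_of_A \<times> L \<union> (M \<union> M\<inverse>))"
    using \<open>finite L\<close> finite_subgroups_of_A \<open>finite M\<close> by (intro card_mono) auto
  also have "\<dots> \<le> (card (L \<times> subgroups_of_A) + card (subgroups_of_A \<times> L)) + (card M + card (M\<inverse>))"
    by (meson add_mono card_Un_le order_trans)
  also have "\<dots> \<le> 4 * (k + 1) * card L"
    using M LB by (simp add: algebra_simps)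
  finally show ?thesis .
qed

end

section \<open>Normal form, finiteness and order in metacyclic groups\<close>

lemma (in group) nat_pow_mod:
  assumes "x \<in> carrier G" "x [^] (m::nat) = \<one>"
  shows "x [^] i = x [^] (i mod m)"
proof -
  have "x [^] i = (x [^] m) [^] (i div m) \<otimes> x [^] (i mod m)"
    using assms(1) by (simp add: nat_pow_pow nat_pow_mult)
  then show ?thesis
    using assms by simp
qed

lemma (in group) inv_eq_nat_pow:
  assumes "x \<in> carrier G" "x [^] (m::nat) = \<one>" "m > 0"
  shows "inv x = x [^] (m - 1)"
proof -
  have "x [^] (m - 1) \<otimes> x = \<one>"
    using assms by (simp flip: nat_pow_Suc)
  then show ?thesis
    using assms by (simp add: inv_equality)
qed

locale metacyclic_group = group +
  fixes a b and m n r :: nat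
  assumes a: "a \<in> carrier G" and b: "b \<in> carrier G"
    and pow_a: "a [^] m = \<one>" and pow_b: "b [^] n = \<one>"
    and conj_a: "inv b \<otimes> a \<otimes> b = a [^] r"
    and m_pos: "m > 0" and n_pos: "n > 0"
    and generate_ab: "generate G {a, b} = carrier G"
begin

lemma pow_a_b: "a [^] (j::nat) \<otimes> b = b \<otimes> a [^] (j * r)"
proof (induction j)
  case (Suc j)
  have ab: "a \<otimes> b = b \<otimes> a [^] r"
    using a b by (simp add: m_assoc flip: conj_a) (simp flip: m_assoc)
  have "a [^] Suc j \<otimes> b = a [^] j \<otimes> b \<otimes> a [^] r"
    using a b by (simp add: m_assoc ab)
  also have "\<dots> = b \<otimes> a [^] (Suc j * r)"
    using a b by (simp add: Suc m_assoc nat_pow_mult add.commute)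
  finally show ?case .
qed (use b in simp)

text \<open>Moving one \<open>b\<close> to the left past a power of \<open>a\<close> multiplies the
  exponent of \<open>a\<close> by \<open>r\<close>; this is the collection rule behind the normal
  form \<open>b [^] i \<otimes> a [^] j\<close>.\<close>

lemma pow_a_pow_b: "a [^] (j::nat) \<otimes> b [^] (i::nat) = b [^] i \<otimes> a [^] (j * r ^ i)"
proof (induction i)
  case (Suc i)
  have "a [^] j \<otimes> b [^] Suc i = b [^] i \<otimes> a [^] (j * r ^ i) \<otimes> b"
    using a b by (simp add: Suc flip: m_assoc)
  also have "\<dots> = b [^] i \<otimes> (b \<otimes> a [^] (j * r ^ i * r))"
    using a b by (simp add: m_assoc pow_a_b)
  finally show ?case
    using a b by (simp add: ac_simps flip: m_assoc)
qed (use a in simp)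

lemma carrier_normal_form: "x \<in> carrier G \<Longrightarrow> \<exists>(i::nat) (j::nat). x = b [^] i \<otimes> a [^] j"
  unfolding generate_ab[symmetric]
proof (induction rule: generate.induct)
  case one
  have "\<one> = b [^] (0::nat) \<otimes> a [^] (0::nat)" by simp
  then show ?case by blast
next
  case (incl h)
  have "a = b [^] (0::nat) \<otimes> a [^] (1::nat)" "b = b [^] (1::nat) \<otimes> a [^] (0::nat)"
    using a b by simp_all
  with incl show ?case by (metis insertE singletonD)
next
  case (inv h)
  \<comment> \<open>Natural exponents suffice for inverses, since \<open>m\<close> and
    \<open>n\<close> are positive.\<close>
  have "inv a = b [^] (0::nat) \<otimes> a [^] (m - 1)" "inv b = b [^] (n - 1) \<otimes> a [^] (0::nat)"
    using a b inv_eq_nat_pow pow_a pow_b m_pos n_pos by simp_all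
  with inv show ?case by (metis insertE singletonD)
next
  case (eng x y)
  then obtain i j k l :: nat where "x = b [^] i \<otimes> a [^] j" "y = b [^] k \<otimes> a [^] l"
    by blast
  then have "x \<otimes> y = b [^] i \<otimes> (a [^] j \<otimes> b [^] k) \<otimes> a [^] l"
    using a b by (simp add: m_assoc)
  also have "\<dots> = b [^] (i + k) \<otimes> a [^] (j * r ^ k + l)"
    using a b by (simp add: pow_a_pow_b m_assoc flip: nat_pow_mult)
  finally show ?case by blast
qed

lemma finite_carrier: "finite (carrier G)"
proof (rule finite_subset)
  show "carrier G \<subseteq> (\<lambda>(i, j). b [^] i \<otimes> a [^] j) ` ({..<n} \<times> {..<m})"
  proof
    fix x assume "x \<in> carrier G"
    then obtain i j :: nat where "x = b [^] i \<otimes> a [^] j"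
      using carrier_normal_form by blast
    then have "x = b [^] (i mod n) \<otimes> a [^] (j mod m)"
      using nat_pow_mod a b pow_a pow_b by metis
    moreover have "(i mod n, j mod m) \<in> {..<n} \<times> {..<m}"
      using m_pos n_pos by simp
    ultimately show "x \<in> (\<lambda>(i, j). b [^] i \<otimes> a [^] j) ` ({..<n} \<times> {..<m})"
      by (metis (no_types, lifting) case_prod_conv image_eqI)
  qed
qed simp

lemma normal_generate_a: "generate G {a} \<lhd> G"
  unfolding normal_inv_iff
proof (intro conjI ballI)
  show "subgroup (generate G {a}) G"
    using a by (simp add: generate_is_subgroup)
  fix x h assume x: "x \<in> carrier G" and "h \<in> generate G {a}"
  then obtain k :: nat where h: "h = a [^] k"
    using generate_pow_on_finite_carrier[OF finite_carrier a] by blast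
  \<comment> \<open>The normal form is taken for \<open>inv x\<close> and not for \<open>x\<close>:
    the collection rule moves the power of \<open>a\<close> across \<open>inv x\<close> from left to
    right, after which \<open>x\<close> and \<open>inv x\<close> cancel.\<close>
  obtain i j :: nat where inv_x: "inv x = b [^] i \<otimes> a [^] j"
    using carrier_normal_form x by blast
  have "h \<otimes> inv x = a [^] k \<otimes> b [^] i \<otimes> a [^] j"
    using a b by (simp add: h inv_x m_assoc)
  also have "\<dots> = b [^] i \<otimes> (a [^] j \<otimes> a [^] (k * r ^ i))"
    using a b by (simp add: pow_a_pow_b m_assoc nat_pow_mult add.commute)
  also have "\<dots> = inv x \<otimes> a [^] (k * r ^ i)"
    using a b by (simp add: inv_x m_assoc)
  finally have "x \<otimes> h \<otimes> inv x = x \<otimes> (inv x \<otimes> a [^] (k * r ^ i))"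
    using x a by (simp add: m_assoc h)
  also have "\<dots> = a [^] (k * r ^ i)"
    using x a by (simp flip: m_assoc)
  finally show "x \<otimes> h \<otimes> inv x \<in> generate G {a}"
    using generate_pow_on_finite_carrier[OF finite_carrier a] by blast
qed

text \<open>By the normal form the group is the product of the subgroups generated by
  \<open>b\<close> and \<open>a\<close>, so its order divides \<open>ord b * ord a\<close>, and
  \<open>ord b\<close> divides \<open>n\<close>.\<close>

lemma order_dvd: "order G dvd n * ord a"
proof -
  have sg: "subgroup (generate G {a}) G" "subgroup (generate G {b}) G"
    using a b by (simp_all add: generate_is_subgroup)
  have "carrier G \<subseteq> generate G {b} <#> generate G {a}"
  proof
    fix x assume "x \<in> carrier G"
    then obtain i j :: nat where "x = b [^] i \<otimes> a [^] j"
      using carrier_normal_form by blast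
    moreover have "b [^] i \<in> generate G {b}" "a [^] j \<in> generate G {a}"
      using generate_pow_on_finite_carrier[OF finite_carrier] a b by blast+
    ultimately show "x \<in> generate G {b} <#> generate G {a}"
      unfolding set_mult_def by blast
  qed
  then have "generate G {b} <#> generate G {a} = carrier G"
    using sg by (intro equalityI set_mult_closed subgroup.subset)
  then have *: "order G * card (generate G {b} \<inter> generate G {a}) = ord b * ord a"
    using card_set_mult_inter[OF finite_carrier sg(2,1)] a b
    by (simp add: order_def generate_pow_card)
  then have "order G dvd ord b * ord a"
    by (metis dvd_triv_left)
  also have "ord b * ord a dvd n * ord a"
    using b pow_b by (simp add: pow_eq_id)
  finally show ?thesis .
qed

end

section \<open>Calculation with classes of words in presented groups\<close>

lemma word_class_eq_iff:
  "word_congruence R `` {u} = word_congruence R `` {v} \<longleftrightarrow> (u, v) \<in> word_congruence R"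
  by (simp add: eq_equiv_class_iff[OF equiv_word_congruence])

lemma presented_group_carrier:
  "carrier (presented_group R) = range (\<lambda>w. word_congruence R `` {w})"
  by (auto simp: presented_group_def quotient_def)

lemma presented_group_one: "\<one>\<^bsub>presented_group R\<^esub> = word_congruence R `` {[]}"
  by (simp add: presented_group_def)

lemma presented_group_pow:
  "(word_congruence R `` {[l]}) [^]\<^bsub>presented_group R\<^esub> k = word_congruence R `` {replicate k l}"
proof (induction k)
  case 0
  show ?case
    using monoid.nat_pow_0[OF group.is_monoid[OF group_presented_group]]
    by (simp add: presented_group_one)
next
  case (Suc k)
  then show ?case
    using monoid.nat_pow_Suc[OF group.is_monoid[OF group_presented_group[of R]]]
    by (simp add: presented_group_mult replicate_append_same)
qed

lemma presented_group_inv_Gen: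
  "inv\<^bsub>presented_group R\<^esub> (word_congruence R `` {[Gen g]}) = word_congruence R `` {[InvGen g]}"
proof (rule group.inv_equality[OF group_presented_group])
  show "word_congruence R `` {[InvGen g]} \<otimes>\<^bsub>presented_group R\<^esub> word_congruence R `` {[Gen g]}
      = \<one>\<^bsub>presented_group R\<^esub>"
    using word_congruence.cancel[of "InvGen g" R]
    by (simp add: presented_group_mult presented_group_one word_class_eq_iff)
qed (auto simp: presented_group_carrier)

lemma presented_group_generate:
  "generate (presented_group R) (range (\<lambda>g. word_congruence R `` {[Gen g]}))
    = carrier (presented_group R)"
    (is "generate ?G ?S = _")
proof
  show "generate ?G ?S \<subseteq> carrier ?G"
    by (rule group.generate_incl[OF group_presented_group]) (auto simp: presented_group_carrier)
  have letter: "word_congruence R `` {[l]} \<in> generate ?G ?S" for l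
    by (cases l) (auto simp flip: presented_group_inv_Gen intro: generate.incl generate.inv)
  have "word_congruence R `` {w} \<in> generate ?G ?S" for w
  proof (induction w)
    case Nil
    show ?case using generate.one[of ?G ?S] by (simp add: presented_group_one)
  next
    case (Cons l w)
    then show ?case
      using generate.eng[OF letter Cons.IH, of l] by (simp add: presented_group_mult)
  qed
  then show "carrier ?G \<subseteq> generate ?G ?S"
    by (auto simp: presented_group_carrier)
qed

section \<open>ZM-groups as metacyclic groups, and their affine action modulo m\<close>

definition ZM_relations :: "nat \<Rightarrow> nat \<Rightarrow> nat \<Rightarrow> (zm_gen letter list \<times> zm_gen letter list) set" where
  "ZM_relations m n r =
     {(replicate m (Gen zm_gen.a), []), (replicate n (Gen zm_gen.b), []),
      ([InvGen zm_gen.b, Gen zm_gen.a, Gen zm_gen.b], replicate r (Gen zm_gen.a))}"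

abbreviation ZM_class :: "nat \<Rightarrow> nat \<Rightarrow> nat \<Rightarrow> zm_gen letter list \<Rightarrow> zm_gen letter list set" where
  "ZM_class m n r w \<equiv> word_congruence (ZM_relations m n r) `` {w}"

lemma ZM_eq: "ZM m n r = presented_group (ZM_relations m n r)"
  by (simp add: ZM_def ZM_relations_def)

lemma group_ZM: "group (ZM m n r)"
  by (simp add: ZM_eq group_presented_group)

text \<open>Each equation required is a defining relation read in the quotient. Nothing is claimed
  here about a collapse of the classes; the affine action below excludes what has to be
  excluded.\<close>

lemma metacyclic_group_ZM:
  assumes "m > 0" "n > 0"
  shows "metacyclic_group (ZM m n r) (ZM_class m n r [Gen zm_gen.a])
    (ZM_class m n r [Gen zm_gen.b]) m n r"
proof -
  interpret group "ZM m n r" by (rule group_ZM)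
  have rel: "ZM_class m n r u = ZM_class m n r v" if "(u, v) \<in> ZM_relations m n r" for u v
    using that by (simp add: word_class_eq_iff word_congruence.rel)
  have UNIV_gen: "(UNIV :: zm_gen set) = {zm_gen.a, zm_gen.b}"
    using zm_gen.exhaust by auto
  show ?thesis
  proof
    show "generate (ZM m n r) {ZM_class m n r [Gen zm_gen.a], ZM_class m n r [Gen zm_gen.b]}
        = carrier (ZM m n r)"
      using presented_group_generate[of "ZM_relations m n r"] by (simp add: ZM_eq UNIV_gen)
  qed (use assms in \<open>auto simp: ZM_eq presented_group_carrier presented_group_pow presented_group_one
        presented_group_inv_Gen presented_group_mult ZM_relations_def intro!: rel[unfolded ZM_relations_def]\<close>)
qed

text \<open>The affine action on the integers modulo \<open>m\<close>. It is a right action, so that words act letter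
  by letter through \<^const>\<open>fold\<close>; \<open>s\<close> is an inverse of \<open>r\<close> modulo \<open>m\<close>.\<close>

fun zm_act :: "int \<Rightarrow> int \<Rightarrow> zm_gen letter \<Rightarrow> int \<Rightarrow> int" where
  "zm_act r s (Gen zm_gen.a) x = x + 1"
| "zm_act r s (InvGen zm_gen.a) x = x - 1"
| "zm_act r s (Gen zm_gen.b) x = x * r"
| "zm_act r s (InvGen zm_gen.b) x = x * s"

lemma zm_act_cong: "[x = y] (mod m) \<Longrightarrow> [fold (zm_act r s) w x = fold (zm_act r s) w y] (mod m)"
proof (induction w arbitrary: x y)
  case (Cons l w)
  have "[zm_act r s l x = zm_act r s l y] (mod m)"
    using Cons.prems by (cases "(r, s, l, x)" rule: zm_act.cases)
      (auto intro: cong_add cong_diff cong_mult)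
  then show ?case using Cons.IH by simp
qed simp

lemma funpow_zm_act:
  "(zm_act r s (Gen zm_gen.a) ^^ k) x = x + int k"
  "(zm_act r s (InvGen zm_gen.a) ^^ k) x = x - int k"
  "(zm_act r s (Gen zm_gen.b) ^^ k) x = x * r ^ k"
  by (induction k) (auto simp: algebra_simps)

text \<open>It is enough that the affine maps satisfy the relations modulo \<open>m\<close>: adding
  \<open>m\<close> is trivial, \<open>r ^ n\<close> is 1, and the conjugate of the translation by 1
  is the translation by \<open>r\<close>. Words that act differently therefore lie in different
  classes.\<close>

lemma zm_act_word_congruence:
  assumes rs: "[r * s = 1] (mod m)" and rn: "[r ^ n = 1] (mod m)" and r: "r = int r'"
    and m: "m = int m'"
    and "(u, v) \<in> word_congruence (ZM_relations m' n r')"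
  shows "[fold (zm_act r s) u x = fold (zm_act r s) v x] (mod m)"
  using assms(5)
proof (induction arbitrary: x rule: word_congruence.induct)
  case (append u v u' v')
  then show ?case
    using zm_act_cong cong_trans by fastforce
next
  case (cancel l)
  have "[x * (r * s) = x * 1] (mod m)"
    using rs by (intro cong_mult) auto
  then show ?case
    by (cases "(r, s, l, x)" rule: zm_act.cases) (auto simp: ac_simps)
next
  case (rel u v)
  have "[x * r ^ n = x * 1] (mod m)" "[x * (r * s) = x * 1] (mod m)"
    using rs rn by (intro cong_mult; simp)+
  then show ?case
    \<comment> \<open>The word for the conjugation relation sends \<open>x\<close> to
      \<open>(x * s + 1) * r\<close>, that is, to \<open>x * (r * s) + r\<close>, which is congruent
      to \<open>x + r\<close>.\<close>
    using rel cong_add[OF _ cong_refl, of "x * (r * s)" x m r]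
    by (auto simp: ZM_relations_def fold_replicate funpow_zm_act r m algebra_simps cong_def)
qed (simp, metis cong_sym, metis cong_trans)

text \<open>This is the stabilizer of the residue of \<open>y\<close>. Membership asks for one
  representing word that fixes \<open>y\<close>; congruent words act alike, so the choice of the
  word is immaterial.\<close>

lemma subgroup_zm_stabilizer:
  assumes rs: "[r * s = 1] (mod m)" and rn: "[r ^ n = 1] (mod m)" and r: "r = int r'"
    and m: "m = int m'"
  shows "subgroup {ZM_class m' n r' w | w. [fold (zm_act r s) w y = y] (mod m)} (ZM m' n r')"
    (is "subgroup ?S ?G")
proof -
  interpret group ?G by (rule group_ZM)
  show ?thesis
  proof (rule subgroupI)
    show "?S \<subseteq> carrier ?G"
      by (auto simp: ZM_eq presented_group_carrier)
    show "?S \<noteq> {}"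
      by (auto intro!: exI[of _ "[]"])
    show "inv\<^bsub>?G\<^esub> g \<in> ?S" if g: "g \<in> ?S" for g
    proof -
      obtain w where w: "g = ZM_class m' n r' w" "[fold (zm_act r s) w y = y] (mod m)"
        using g by blast
      then have gc: "g \<in> carrier ?G" by (simp add: ZM_eq presented_group_carrier)
      then obtain v where v: "inv\<^bsub>?G\<^esub> g = ZM_class m' n r' v"
        using inv_closed[OF gc] by (auto simp: ZM_eq presented_group_carrier)
      have "g \<otimes>\<^bsub>?G\<^esub> inv\<^bsub>?G\<^esub> g = \<one>\<^bsub>?G\<^esub>"
        using gc by simp
      \<comment> \<open>The word \<open>w @ v\<close> acts trivially and \<open>w\<close> fixes
        \<open>y\<close>, hence so does \<open>v\<close>.\<close>
      then have "(w @ v, []) \<in> word_congruence (ZM_relations m' n r')"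
        unfolding v unfolding w(1) by (simp add: ZM_eq presented_group_mult presented_group_one word_class_eq_iff)
      from zm_act_word_congruence[OF rs rn r m this, of y]
      have "[fold (zm_act r s) v (fold (zm_act r s) w y) = y] (mod m)"
        by simp
      then have "[fold (zm_act r s) v y = y] (mod m)"
        using zm_act_cong[OF w(2)] cong_trans cong_sym by blast
      then show ?thesis using v by blast
    qed
    show "g \<otimes>\<^bsub>?G\<^esub> h \<in> ?S" if gh: "g \<in> ?S" "h \<in> ?S" for g h
    proof -
      obtain u v where uv: "g = ZM_class m' n r' u" "[fold (zm_act r s) u y = y] (mod m)"
        "h = ZM_class m' n r' v" "[fold (zm_act r s) v y = y] (mod m)"
        using gh by blast
      have "[fold (zm_act r s) (u @ v) y = y] (mod m)"
        using zm_act_cong[OF uv(2)] uv(4) cong_trans by fastforce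
      then show ?thesis
        using uv by (auto simp: ZM_eq presented_group_mult)
    qed
  qed
qed

text \<open>The conjugate of \<open>b\<close> by \<open>a\<^sup>x\<close>; it fixes the point \<open>x\<close> and, as \<open>r - 1\<close> is a unit modulo
  \<open>m\<close>, no other.\<close>

definition zm_conj_word :: "nat \<Rightarrow> zm_gen letter list" where
  "zm_conj_word x = replicate x (InvGen zm_gen.a) @ Gen zm_gen.b # replicate x (Gen zm_gen.a)"

lemma fold_zm_conj_word: "fold (zm_act r s) (zm_conj_word x) y = (y - int x) * r + int x"
  by (simp add: zm_conj_word_def fold_replicate funpow_zm_act)

text \<open>If the conjugates for \<open>x\<close> and \<open>y\<close> generate the same subgroup,
  the one for \<open>x\<close> lies in the stabilizer of \<open>y\<close>. Then \<open>m\<close>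
  divides \<open>(y - x) * (r - 1)\<close>, hence \<open>y - x\<close>, and both numbers are below
  \<open>m\<close>.\<close>

lemma generate_zm_conj_inj:
  assumes rn: "[r ^ n = 1] (mod m)" and "n > 0" and r1: "coprime (int m) (int r - 1)"
  shows "inj_on (\<lambda>x. generate (ZM m n r) {ZM_class m n r (zm_conj_word x)}) {..<m}"
    (is "inj_on (\<lambda>x. generate ?G {?g x}) _")
proof (rule inj_onI)
  fix x y assume x: "x \<in> {..<m}" and y: "y \<in> {..<m}" and eq: "generate ?G {?g x} = generate ?G {?g y}"
  interpret group ?G by (rule group_ZM)
  \<comment> \<open>An inverse of \<open>r\<close> modulo \<open>m\<close>, because
    \<open>r ^ n\<close> is congruent to 1 and \<open>n\<close> is positive.\<close>
  define s where "s = int r ^ (n - 1)"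
  have rn': "[int r ^ n = 1] (mod int m)"
    using rn by (metis cong_int_iff of_nat_1 of_nat_power)
  then have rs: "[int r * s = 1] (mod int m)"
    using \<open>n > 0\<close> by (simp add: s_def flip: power_Suc)
  let ?S = "{ZM_class m n r w | w. [fold (zm_act r s) w y = y] (mod m)}"
  have "?g y \<in> ?S"
    by (auto simp: fold_zm_conj_word intro!: exI[of _ "zm_conj_word y"])
  then have "generate ?G {?g y} \<subseteq> ?S"
    using generate_subgroup_incl[OF _ subgroup_zm_stabilizer[OF rs rn' HOL.refl HOL.refl]] by blast
  then have "?g x \<in> ?S"
    using generate.incl[of "?g x" "{?g x}" ?G] eq by auto
  then obtain w where w: "(zm_conj_word x, w) \<in> word_congruence (ZM_relations m n r)"
      "[fold (zm_act r s) w y = y] (mod m)"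
    unfolding mem_Collect_eq word_class_eq_iff by blast
  then have "[fold (zm_act r s) (zm_conj_word x) y = y] (mod m)"
    using zm_act_word_congruence[OF rs rn' HOL.refl HOL.refl] cong_trans by blast
  then have "int m dvd (int y - int x) * (int r - 1)"
    by (simp add: fold_zm_conj_word cong_iff_dvd_diff algebra_simps)
  then have "[int y = int x] (mod int m)"
    using r1 by (simp add: cong_iff_dvd_diff coprime_dvd_mult_left_iff)
  then show "x = y"
    using x y by (simp add: cong_def flip: of_nat_mod)
qed

section \<open>Bounds for the two degrees and their limits\<close>

lemma finite_ZM: "m > 0 \<Longrightarrow> n > 0 \<Longrightarrow> finite (carrier (ZM m n r))"
  using metacyclic_group.finite_carrier[OF metacyclic_group_ZM] .

lemma card_cyclic_subgroups_of_ZM_ge: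
  assumes "[r ^ n = 1] (mod m)" "m > 0" "n > 0" "coprime (int m) (int r - 1)"
  shows "card (cyclic_subgroups_of (ZM m n r)) \<ge> m"
proof -
  interpret group "ZM m n r" by (rule group_ZM)
  let ?gen = "\<lambda>x. generate (ZM m n r) {ZM_class m n r (zm_conj_word x)}"
  have gc: "ZM_class m n r (zm_conj_word x) \<in> carrier (ZM m n r)" for x
    by (simp add: ZM_eq presented_group_carrier)
  have "cyclic_group ((ZM m n r)\<lparr>carrier := ?gen x\<rparr>)" for x
    \<comment> \<open>\<open>subgroup_generated\<close> intersects the generating set with the
      carrier; membership of the generator removes this intersection.\<close>
    using cyclic_group_generated[of "ZM_class m n r (zm_conj_word x)"] gc[of x]
    by (simp only: subgroup_generated_def Int_insert_right_if1 Int_empty_right)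
  then have "?gen x \<in> cyclic_subgroups_of (ZM m n r)" for x
    using gc[of x] by (simp add: cyclic_subgroups_of_def generate_is_subgroup)
  moreover have "finite (cyclic_subgroups_of (ZM m n r))"
    by (rule finite_subset[of _ "Pow (carrier (ZM m n r))"])
      (use assms in \<open>auto simp: cyclic_subgroups_of_def finite_ZM dest: subgroup.subset\<close>)
  ultimately have "card {..<m} \<le> card (cyclic_subgroups_of (ZM m n r))"
    using generate_zm_conj_inj assms by (intro card_inj_on_le[of ?gen]) auto
  then show ?thesis by simp
qed

text \<open>At most \<open>4 * (k + 1) * card L\<close> pairs are permutable, while \<open>L\<close>
  has at least \<open>p ^ k\<close> members because it contains all cyclic subgroups. The two
  extreme choices of \<open>L\<close> give \<open>csd\<close> and \<open>sd\<close>.\<close>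

lemma permutability_ratio_ZM_le:
  assumes p: "prime p" and n: "prime n" and "gcd (p ^ k) n = 1" and "k \<ge> 1"
    and r1: "gcd (int (p ^ k)) (int r - 1) = 1" and rn: "[r ^ n = 1] (mod p ^ k)"
    and L: "cyclic_subgroups_of (ZM (p ^ k) n r) \<subseteq> L" "L \<subseteq> subgroups_of (ZM (p ^ k) n r)"
  shows "real (card {(H, K). H \<in> L \<and> K \<in> L \<and> H <#>\<^bsub>ZM (p ^ k) n r\<^esub> K = K <#>\<^bsub>ZM (p ^ k) n r\<^esub> H})
    / (real (card L))\<^sup>2 \<le> 4 * (real k + 1) / real p ^ k"
proof -
  have pos: "p ^ k > 0" "n > 0" using p n by (auto simp: prime_gt_0_nat)
  interpret metacyclic_group "ZM (p ^ k) n r" "ZM_class (p ^ k) n r [Gen zm_gen.a]"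
    "ZM_class (p ^ k) n r [Gen zm_gen.b]" "p ^ k" n r
    using pos by (rule metacyclic_group_ZM)
  interpret prime_index_cyclic_normal "ZM (p ^ k) n r" "ZM_class (p ^ k) n r [Gen zm_gen.a]" p n k
  proof (intro prime_index_cyclic_normal.intro prime_index_cyclic_normal_axioms.intro group_axioms)
    show "n \<noteq> p"
      using assms(3,4) n by (auto simp: prime_gt_Suc_0_nat coprime_power_left_iff simp flip: coprime_iff_gcd_eq_1)
  qed (use finite_carrier a normal_generate_a p n pow_a order_dvd in \<open>simp_all add: pow_eq_id\<close>)
  let ?P = "{(H, K). H \<in> L \<and> K \<in> L \<and> H <#>\<^bsub>ZM (p ^ k) n r\<^esub> K = K <#>\<^bsub>ZM (p ^ k) n r\<^esub> H}"
  have "L \<subseteq> {H. subgroup H (ZM (p ^ k) n r)}"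
    using L(2) by (simp add: subgroups_of_def)
  then have P: "card ?P \<le> 4 * (k + 1) * card L" and "finite L"
    using card_permutable_pairs_le finite_subgroups by (auto intro: finite_subset)
  have "p ^ k \<le> card (cyclic_subgroups_of (ZM (p ^ k) n r))"
    using card_cyclic_subgroups_of_ZM_ge[OF rn pos] r1 by (simp add: coprime_iff_gcd_eq_1)
  also have "\<dots> \<le> card L"
    using \<open>finite L\<close> L(1) by (rule card_mono)
  finally have "p ^ k \<le> card L" .
  then have le: "real p ^ k \<le> real (card L)" and "card L > 0"
    using pos(1) by (simp flip: of_nat_power, linarith)
  have "real (card ?P) \<le> 4 * (real k + 1) * real (card L)"
    using of_nat_mono[OF P, where 'a = real] by (simp add: algebra_simps)
  then have "real (card ?P) / (real (card L))\<^sup>2 \<le> 4 * (real k + 1) * real (card L) / (real (card L))\<^sup>2"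
    by (intro divide_right_mono) auto
  also have "\<dots> = 4 * (real k + 1) / real (card L)"
    using \<open>card L > 0\<close> by (simp add: power2_eq_square)
  also have "\<dots> \<le> 4 * (real k + 1) / real p ^ k"
    using le p \<open>card L > 0\<close> by (intro divide_left_mono) (auto simp: prime_gt_0_nat)
  finally show ?thesis .
qed

theorem corollary4p6:
  fixes n p :: nat and r :: "nat \<Rightarrow> nat"
  assumes "prime n" and "prime p" and "p \<ge> 3"
    and "\<And>\<alpha>. \<alpha> \<ge> 1 \<Longrightarrow> gcd (p ^ \<alpha>) n = 1"
    and "\<And>\<alpha>. \<alpha> \<ge> 1 \<Longrightarrow> gcd (int (p ^ \<alpha>)) (int (r \<alpha>) - 1) = 1"
    and "\<And>\<alpha>. \<alpha> \<ge> 1 \<Longrightarrow> [r \<alpha> ^ n = 1] (mod p ^ \<alpha>)"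
  shows "((\<lambda>\<alpha>. sd (ZM (p ^ \<alpha>) n (r \<alpha>))) \<longlonglongrightarrow> 0) \<and>
         ((\<lambda>\<alpha>. csd (ZM (p ^ \<alpha>) n (r \<alpha>))) \<longlonglongrightarrow> 0)"
proof -
  have "norm (1 / real p) < 1"
    using assms(3) by simp
  then have "(\<lambda>k. real k * (1 / real p) ^ k) \<longlonglongrightarrow> 0" "(\<lambda>k. (1 / real p) ^ k) \<longlonglongrightarrow> 0"
    using powser_times_n_limit_0[of "1 / real p"] LIMSEQ_power_zero[of "1 / real p"] by auto
  from tendsto_mult[OF tendsto_const[of "4 :: real"] tendsto_add[OF this]]
  have "(\<lambda>k. 4 * (real k * (1 / real p) ^ k + (1 / real p) ^ k)) \<longlonglongrightarrow> 4 * (0 + 0)" .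
  \<comment> \<open>The bound splits into \<open>k * x ^ k\<close> and \<open>x ^ k\<close> with
    \<open>x = 1 / p\<close>, both of which tend to 0.\<close>
  moreover have "4 * (real k * (1 / real p) ^ k + (1 / real p) ^ k) = 4 * (real k + 1) / real p ^ k" for k
    by (simp add: power_divide add_divide_distrib distrib_left distrib_right)
  ultimately have lim: "(\<lambda>k. 4 * (real k + 1) / real p ^ k) \<longlonglongrightarrow> 0"
    by simp
  have sub: "cyclic_subgroups_of G \<subseteq> subgroups_of G" for G :: "zm_gen letter list set monoid"
    by (auto simp: cyclic_subgroups_of_def subgroups_of_def)
  have "sd (ZM (p ^ \<alpha>) n (r \<alpha>)) \<le> 4 * (real \<alpha> + 1) / real p ^ \<alpha>"
    "csd (ZM (p ^ \<alpha>) n (r \<alpha>)) \<le> 4 * (real \<alpha> + 1) / real p ^ \<alpha>" if "\<alpha> \<ge> 1" for \<alpha>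
    unfolding sd_def csd_def using assms that sub by (intro permutability_ratio_ZM_le; simp)+
  \<comment> \<open>The hypotheses on \<open>r\<close> are available from \<alpha> = 1 on, so the
    estimates hold eventually.\<close>
  then have "\<forall>\<^sub>F \<alpha> in sequentially. sd (ZM (p ^ \<alpha>) n (r \<alpha>)) \<le> 4 * (real \<alpha> + 1) / real p ^ \<alpha>"
    "\<forall>\<^sub>F \<alpha> in sequentially. csd (ZM (p ^ \<alpha>) n (r \<alpha>)) \<le> 4 * (real \<alpha> + 1) / real p ^ \<alpha>"
    by (auto intro: eventually_sequentiallyI[of 1])
  then show ?thesis
    by (intro conjI tendsto_sandwich[OF _ _ tendsto_const lim]) (auto simp: sd_def csd_def)
qed

end
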